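(* Let $K$ be a field, let $A$ be a unital $\mathbb Z$-graded $K$-algebra and let $\tau$ be a twisting system on $A$. Then $A$ has gr-IBN if and only if the Zhang twist $A^{\tau}$ has gr-IBN, and the two algebras have the same graded module type. Moreover, IBN implies gr-IBN.
   Context: Let $A=\bigoplus_{n\in\mathbb Z}A_n$ be a $\mathbb Z$-graded $K$-algebra. A twisting system on $A$ is a set $\tau=\{\tau_n\mid n\in\mathbb Z\}$ of graded (degree-preserving) $K$-linear automorphisms (bijections) of $A$ such that $\tau_n(y\,\tau_m(z))=\tau_n(y)\,\tau_{n+m}(z)$ for all $n,m,l\in\mathbb Z$, $y\in A_m$, $z\in A_l$. The Zhang twist $A^\tau$ is the graded algebra with the same underlying graded $K$-vector space and multiplication $y\star z=y\,\tau_m(z)$ for $y\in A_m$, $z\in A$. A unital ring $R$ has IBN if $R^m\cong R^n$ as right $R$-modules implies $m=n$ (for positive integers $m,n$). A $\mathbb Z$-graded algebra $A$ has gr-IBN if every isomorphism $A^n\cong A^m$ of graded right $A$-modules (degree-preserving isomorphism, where $A^n$ is the direct sum of $n$ unshifted copies of $A_A$) implies $m=n$. If $A$ does not have gr-IBN, its graded module type is the pair $(m,n)$ with $m<n$ and $A^m\cong A^n$ as graded right modules, where $m$ is minimal and, subject to this, $n$ is minimal. *)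

theory Defs
  imports "HOL-Algebra.Algebra"
begin

text \<open>
  A record for graded objects over scalars of type \<open>'k\<close>. It is used for graded algebras, and
  (ignoring the inherited fields \<open>mult\<close> and \<open>one\<close>) for graded right modules. In the
  latter case \<open>smult M r v\<close> stands for the right action \<open>v \<cdot> r\<close>.
\<close>

record ('k, 'a) graded = "('k, 'a) module" +
  grade :: "int \<Rightarrow> 'a set"

definition is_decomposition ::
    "('k, 'a, 'e) graded_scheme \<Rightarrow> 'a \<Rightarrow> (int \<Rightarrow> 'a) \<Rightarrow> bool" where
  "is_decomposition A x c \<longleftrightarrow>
     (\<forall>n. c n \<in> grade A n) \<and> finite {n. c n \<noteq> \<zero>\<^bsub>A\<^esub>} \<and>
     x = (\<Oplus>\<^bsub>A\<^esub>n\<in>{n. c n \<noteq> \<zero>\<^bsub>A\<^esub>}. c n)"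

definition homogeneous_component ::
    "('k, 'a, 'e) graded_scheme \<Rightarrow> 'a \<Rightarrow> int \<Rightarrow> 'a" where
  "homogeneous_component A x = (THE c. is_decomposition A x c)"

text \<open>
  Unital, associative, not necessarily commutative. The library locale \<open>algebra\<close> is not
  usable here, as it assumes commutativity. That the unit is homogeneous of degree \<open>0\<close> follows
  from the axioms and is not assumed.
\<close>

locale graded_algebra = K?: field K + A?: ring A + module K A
  for K :: "('k, 'c) ring_scheme" and A :: "('k, 'a, 'e) graded_scheme" (structure) +
  assumes smult_mult_left:
      "\<lbrakk>a \<in> carrier K; x \<in> carrier A; y \<in> carrier A\<rbrakk> \<Longrightarrow> (a \<odot> x) \<otimes> y = a \<odot> (x \<otimes> y)"
    and smult_mult_right:
      "\<lbrakk>a \<in> carrier K; x \<in> carrier A; y \<in> carrier A\<rbrakk> \<Longrightarrow> x \<otimes> (a \<odot> y) = a \<odot> (x \<otimes> y)"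
    and grade_submodule: "submodule (grade A n) K A"
    and grade_mult: "\<lbrakk>x \<in> grade A m; y \<in> grade A n\<rbrakk> \<Longrightarrow> x \<otimes> y \<in> grade A (m + n)"
    and grade_direct_sum: "x \<in> carrier A \<Longrightarrow> \<exists>!c. is_decomposition A x c"

locale twisting_system = graded_algebra K A
  for K :: "('k, 'c) ring_scheme" and A :: "('k, 'a, 'e) graded_scheme" (structure)
    and \<tau> :: "int \<Rightarrow> 'a \<Rightarrow> 'a" +
  assumes twist_iso: "\<tau> n \<in> iso (add_monoid A) (add_monoid A)"
    and twist_smult: "\<lbrakk>a \<in> carrier K; x \<in> carrier A\<rbrakk> \<Longrightarrow> \<tau> n (a \<odot> x) = a \<odot> \<tau> n x"
    and twist_grade: "x \<in> grade A m \<Longrightarrow> \<tau> n x \<in> grade A m"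
    and twist_mult:
      "\<lbrakk>y \<in> grade A m; z \<in> grade A l\<rbrakk> \<Longrightarrow> \<tau> n (y \<otimes> \<tau> m z) = \<tau> n y \<otimes> \<tau> (n + m) z"

text \<open>
  The product \<open>y \<star> z = y \<otimes> \<tau> m z\<close> for \<open>y\<close> of degree \<open>m\<close>, extended additively in \<open>y\<close>.
  The identity element of the twist is in general not that of \<open>A\<close>, see \<open>zhang_twist_one\<close> below.
\<close>

definition zhang_twist ::
    "('k, 'a, 'e) graded_scheme \<Rightarrow> (int \<Rightarrow> 'a \<Rightarrow> 'a) \<Rightarrow> ('k, 'a, 'e) graded_scheme" where
  "zhang_twist A \<tau> = A
     \<lparr>monoid.mult := \<lambda>y z. \<Oplus>\<^bsub>A\<^esub>m\<in>{m. homogeneous_component A y m \<noteq> \<zero>\<^bsub>A\<^esub>}.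
                 homogeneous_component A y m \<otimes>\<^bsub>A\<^esub> \<tau> m z,
      one := inv_into (carrier A) (\<tau> 0) \<one>\<^bsub>A\<^esub>\<rparr>"

definition right_module_iso ::
    "('a, 'm) ring_scheme \<Rightarrow> ('a, 'b, 'n) module_scheme \<Rightarrow> ('a, 'd, 'p) module_scheme
      \<Rightarrow> ('b \<Rightarrow> 'd) set" where
  "right_module_iso R M N =
     {f \<in> iso (add_monoid M) (add_monoid N).
        \<forall>r\<in>carrier R. \<forall>v\<in>carrier M. f (r \<odot>\<^bsub>M\<^esub> v) = r \<odot>\<^bsub>N\<^esub> f v}"

definition graded_right_module_iso ::
    "('a, 'm) ring_scheme \<Rightarrow> ('a, 'b, 'n) graded_scheme \<Rightarrow> ('a, 'd, 'p) graded_scheme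
      \<Rightarrow> ('b \<Rightarrow> 'd) set" where
  "graded_right_module_iso R M N =
     {f \<in> right_module_iso R M N. \<forall>d. \<forall>v\<in>grade M d. f v \<in> grade N d}"

text \<open>The right module \<open>R\<^sup>n\<close>; the fields \<open>mult\<close> and \<open>one\<close> are junk.\<close>

definition free_right_module ::
    "('a, 'm) ring_scheme \<Rightarrow> nat \<Rightarrow> ('a, nat \<Rightarrow> 'a) module" where
  "free_right_module R n =
     \<lparr>carrier = {..<n} \<rightarrow>\<^sub>E carrier R,
      monoid.mult = undefined,
      one = undefined,
      ring.zero = (\<lambda>i\<in>{..<n}. \<zero>\<^bsub>R\<^esub>),
      ring.add = (\<lambda>v w. \<lambda>i\<in>{..<n}. v i \<oplus>\<^bsub>R\<^esub> w i),
      module.smult = (\<lambda>r v. \<lambda>i\<in>{..<n}. v i \<otimes>\<^bsub>R\<^esub> r)\<rparr>"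

definition free_graded_right_module ::
    "('k, 'a, 'e) graded_scheme \<Rightarrow> nat \<Rightarrow> ('a, nat \<Rightarrow> 'a) graded" where
  "free_graded_right_module A n =
     module.extend (free_right_module A n)
       (graded.fields (\<lambda>d. {..<n} \<rightarrow>\<^sub>E grade A d))"

definition IBN :: "('a, 'm) ring_scheme \<Rightarrow> bool" where
  "IBN R \<longleftrightarrow>
     (\<forall>m n. 0 < m \<longrightarrow> 0 < n \<longrightarrow>
        right_module_iso R (free_right_module R m) (free_right_module R n) \<noteq> {} \<longrightarrow> m = n)"

definition free_graded_isomorphic :: "('k, 'a, 'e) graded_scheme \<Rightarrow> nat \<Rightarrow> nat \<Rightarrow> bool" where
  "free_graded_isomorphic A m n \<longleftrightarrow>
     graded_right_module_iso A (free_graded_right_module A m) (free_graded_right_module A n) \<noteq> {}"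

definition gr_IBN :: "('k, 'a, 'e) graded_scheme \<Rightarrow> bool" where
  "gr_IBN A \<longleftrightarrow>
     (\<forall>m n. 0 < m \<longrightarrow> 0 < n \<longrightarrow> free_graded_isomorphic A m n \<longrightarrow> m = n)"

text \<open>Only meaningful if \<open>A\<close> does not have gr-IBN; both ranks are taken to be positive.\<close>

definition graded_module_type :: "('k, 'a, 'e) graded_scheme \<Rightarrow> nat \<times> nat" where
  "graded_module_type A =
     (let m = (LEAST m. 0 < m \<and> (\<exists>n>m. free_graded_isomorphic A m n));
          n = (LEAST n. m < n \<and> free_graded_isomorphic A m n)
      in (m, n))"


subsection \<open>The product and the identity element of the twist\<close>

context graded_algebra
begin

lemma grade_closed: "x \<in> grade A n \<Longrightarrow> x \<in> carrier A"
  using submodule.axioms(1)[OF grade_submodule[of n]] subgroup.subset by fastforce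

lemma grade_zero: "\<zero> \<in> grade A n"
  using subgroup.one_closed[OF submodule.axioms(1)[OF grade_submodule[of n]]] by simp

lemma homogeneous_component_eq:
  assumes "is_decomposition A x c" "x \<in> carrier A"
  shows "homogeneous_component A x = c"
  unfolding homogeneous_component_def
  using assms grade_direct_sum[OF assms(2)] by (intro the1_equality)

lemma is_decomposition_homogeneous_component:
  "x \<in> carrier A \<Longrightarrow> is_decomposition A x (homogeneous_component A x)"
  unfolding homogeneous_component_def by (rule theI'[OF grade_direct_sum])

lemma homogeneous_component_homogeneous:
  assumes "y \<in> grade A m"
  shows "homogeneous_component A y = (\<lambda>n. if n = m then y else \<zero>)"
proof (rule homogeneous_component_eq)
  have y: "y \<in> carrier A" using assms grade_closed by blast
  then show "y \<in> carrier A" .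
  have *: "{n. (if n = m then y else \<zero>) \<noteq> \<zero>} = (if y = \<zero> then {} else {m})" by auto
  show "is_decomposition A y (\<lambda>n. if n = m then y else \<zero>)"
    unfolding is_decomposition_def * using assms y
    by (auto simp: grade_zero)
qed

lemma decomposition_sum:
  assumes "x \<in> carrier A"
  defines "c \<equiv> homogeneous_component A x"
  shows "c n \<in> grade A n" "finite {n. c n \<noteq> \<zero>}" "(\<Oplus>n\<in>{n. c n \<noteq> \<zero>}. c n) = x"
  using is_decomposition_homogeneous_component[OF assms(1)]
  unfolding is_decomposition_def c_def by auto

lemma one_homogeneous: "\<one> \<in> grade A 0"
proof -
  define c where "c = homogeneous_component A \<one>"
  define S where "S = {n. c n \<noteq> \<zero>}"
  have c: "c n \<in> grade A n" and fin: "finite S" and sum: "(\<Oplus>n\<in>S. c n) = \<one>" for n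
    using decomposition_sum[of \<one>] by (auto simp: c_def S_def)
  have cc: "c n \<in> carrier A" for n
    using c grade_closed by blast
  have *: "x \<otimes> c 0 = x" if x: "x \<in> grade A k" for x k
  proof -
    have xc: "x \<in> carrier A" using x grade_closed by blast
    define d where "d j = x \<otimes> c (j - k)" for j
    define T where "T = {j. d j \<noteq> \<zero>}"
    have dc: "d j \<in> carrier A" for j using xc cc by (simp add: d_def)
    have sub: "T \<subseteq> (\<lambda>n. n + k) ` S"
    proof
      fix j assume "j \<in> T"
      then have "j - k \<in> S" using xc by (auto simp: T_def d_def S_def)
      then show "j \<in> (\<lambda>n. n + k) ` S" by (intro image_eqI[of _ _ "j - k"]) auto
    qed
    have "x = x \<otimes> (\<Oplus>n\<in>S. c n)" using sum xc by simp
    also have "\<dots> = (\<Oplus>n\<in>S. x \<otimes> c n)"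
      using fin xc cc by (intro finsum_rdistr) auto
    also have "\<dots> = (\<Oplus>n\<in>S. d (n + k))" by (simp add: d_def)
    also have "\<dots> = (\<Oplus>j\<in>(\<lambda>n. n + k) ` S. d j)"
      using dc by (intro A.finsum_reindex[symmetric]) (auto intro: inj_onI)
    also have "\<dots> = (\<Oplus>j\<in>T. d j)"
      using fin sub dc by (intro A.add.finprod_mono_neutral_cong_right) (auto simp: T_def)
    finally have sum_d: "x = (\<Oplus>j\<in>T. d j)" .
    have "d j \<in> grade A j" for j
      using grade_mult[OF x c[of "j - k"]] by (simp add: d_def)
    moreover have "finite T" using sub fin finite_subset by blast
    ultimately have "is_decomposition A x d"
      using sum_d by (simp add: is_decomposition_def T_def)
    then have "homogeneous_component A x = d" using xc homogeneous_component_eq by blast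
    then have "d = (\<lambda>n. if n = k then x else \<zero>)"
      using homogeneous_component_homogeneous[OF x] by simp
    then have "d k = x" by simp
    then show ?thesis by (simp add: d_def)
  qed
  have "c 0 = (\<Oplus>n\<in>S. c n) \<otimes> c 0" using sum cc by simp
  also have "\<dots> = (\<Oplus>n\<in>S. c n \<otimes> c 0)" using fin cc by (intro finsum_ldistr) auto
  also have "\<dots> = (\<Oplus>n\<in>S. c n)" using *[OF c] by simp
  finally show ?thesis using sum c by metis
qed

end

context twisting_system
begin

lemma twist_closed: "x \<in> carrier A \<Longrightarrow> \<tau> n x \<in> carrier A"
  using twist_iso[of n] by (auto simp: iso_def hom_def)

lemma zhang_twist_mult_homogeneous:
  assumes "y \<in> grade A m" "z \<in> carrier A"
  shows "y \<otimes>\<^bsub>zhang_twist A \<tau>\<^esub> z = y \<otimes> \<tau> m z"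
proof -
  have y: "y \<in> carrier A" using assms grade_closed by blast
  have *: "{n. (if n = m then y else \<zero>) \<noteq> \<zero>} = (if y = \<zero> then {} else {m})" by auto
  show ?thesis
    using y assms
    by (simp add: zhang_twist_def homogeneous_component_homogeneous[OF assms(1)] *
        twist_closed)
qed

lemma twist_hom: "group_hom (add_monoid A) (add_monoid A) (\<tau> n)"
  using twist_iso[of n] A.a_group by (auto simp: group_hom_def group_hom_axioms_def iso_def)

lemma twist_zero: "\<tau> n \<zero> = \<zero>"
  using group_hom.hom_one[OF twist_hom[of n]] by simp

lemma twist_add:
  "\<lbrakk>x \<in> carrier A; y \<in> carrier A\<rbrakk> \<Longrightarrow> \<tau> n (x \<oplus> y) = \<tau> n x \<oplus> \<tau> n y"
  using group_hom.hom_mult[OF twist_hom[of n], of x y] by simp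

lemma twist_bij: "bij_betw (\<tau> n) (carrier A) (carrier A)"
  using twist_iso[of n] by (simp add: iso_def)

lemma twist_finsum:
  assumes "finite S" "\<And>i. i \<in> S \<Longrightarrow> f i \<in> carrier A"
  shows "\<tau> n (\<Oplus>i\<in>S. f i) = (\<Oplus>i\<in>S. \<tau> n (f i))"
  using assms
proof (induction S)
  case empty
  then show ?case by (simp add: twist_zero)
next
  case (insert a S)
  then show ?case by (simp add: twist_add twist_closed Pi_iff)
qed

lemma twist_component:
  assumes "x \<in> carrier A"
  shows "homogeneous_component A (\<tau> n x) = (\<lambda>m. \<tau> n (homogeneous_component A x m))"
proof (rule homogeneous_component_eq)
  define c where "c = homogeneous_component A x"
  have c: "c m \<in> grade A m" and fin: "finite {m. c m \<noteq> \<zero>}"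
    and sum: "(\<Oplus>m\<in>{m. c m \<noteq> \<zero>}. c m) = x" for m
    using decomposition_sum[OF assms] by (auto simp: c_def)
  have cc: "c m \<in> carrier A" for m using c grade_closed by blast
  have eq: "{m. \<tau> n (c m) \<noteq> \<zero>} = {m. c m \<noteq> \<zero>}"
    using twist_bij[of n] cc twist_zero[of n] by (auto simp: bij_betw_def inj_on_def)
  have "\<tau> n x = (\<Oplus>m\<in>{m. c m \<noteq> \<zero>}. \<tau> n (c m))"
    using twist_finsum[OF fin, of c n] cc sum by simp
  then show "is_decomposition A (\<tau> n x) (\<lambda>m. \<tau> n (homogeneous_component A x m))"
    using fin c twist_grade unfolding c_def[symmetric] is_decomposition_def eq by auto
  show "\<tau> n x \<in> carrier A" using assms twist_closed by blast
qed

lemma zhang_twist_one: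
  defines "e \<equiv> \<one>\<^bsub>zhang_twist A \<tau>\<^esub>"
  shows "e \<in> grade A 0" "\<tau> n e = \<one>"
    and "x \<in> carrier A \<Longrightarrow> x \<otimes>\<^bsub>zhang_twist A \<tau>\<^esub> e = x"
    and "x \<in> carrier A \<Longrightarrow> e \<otimes>\<^bsub>zhang_twist A \<tau>\<^esub> x = x"
proof -
  have e: "e \<in> carrier A" "\<tau> 0 e = \<one>"
    using twist_bij[of 0] unfolding e_def zhang_twist_def
    by (auto simp: bij_betw_def inv_into_into f_inv_into_f)
  have inj: "\<tau> n u = \<tau> n v \<Longrightarrow> u \<in> carrier A \<Longrightarrow> v \<in> carrier A \<Longrightarrow> u = v" for n u v
    using twist_bij[of n] by (auto simp: bij_betw_def inj_on_def)
  have "\<tau> 0 (homogeneous_component A e m) = (if m = 0 then \<one> else \<zero>)" for m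
    using twist_component[OF e(1), of 0] homogeneous_component_homogeneous[OF one_homogeneous]
    unfolding e(2) by metis
  then have "homogeneous_component A e m = (if m = 0 then e else \<zero>)" for m
    using inj[of 0 "homogeneous_component A e m"] e decomposition_sum(1)[OF e(1)] grade_closed
      twist_zero A.zero_closed by (metis (full_types))
  then show e0: "e \<in> grade A 0" using decomposition_sum(1)[OF e(1), of 0] by simp
  show one: "\<tau> n e = \<one>" for n
  proof -
    have "\<one> \<in> \<tau> n ` grade A 0"
    proof -
      obtain u where u: "u \<in> carrier A" "\<tau> n u = \<one>"
        using twist_bij[of n] by (metis A.one_closed bij_betw_def imageE)
      have "\<tau> n (homogeneous_component A u 0) = \<one>"
        using twist_component[OF u(1), of n] u(2)
          homogeneous_component_homogeneous[OF one_homogeneous] by metis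
      then show ?thesis using decomposition_sum(1)[OF u(1)] by (metis imageI)
    qed
    then obtain u where u: "u \<in> grade A 0" "\<tau> n u = \<one>" by auto
    have "\<tau> n (u \<otimes> \<tau> 0 e) = \<tau> n u \<otimes> \<tau> (n + 0) e" using twist_mult[OF u(1) e0] .
    then show ?thesis using u e grade_closed[OF u(1)] by (simp add: twist_closed)
  qed
  show "x \<otimes>\<^bsub>zhang_twist A \<tau>\<^esub> e = x" if x: "x \<in> carrier A"
  proof -
    have "homogeneous_component A x m \<in> carrier A" for m
      using decomposition_sum(1)[OF x] grade_closed by blast
    then show ?thesis using decomposition_sum(3)[OF x]
      by (simp add: zhang_twist_def[of A] one)
  qed
  have hom: "e \<otimes> \<tau> 0 z = z" if z: "z \<in> grade A l" for z l
  proof (rule inj[of 0])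
    show "\<tau> 0 (e \<otimes> \<tau> 0 z) = \<tau> 0 z"
      using twist_mult[OF e0 z, of 0] e grade_closed[OF z] twist_closed by simp
  qed (use e z grade_closed twist_closed in auto)
  show "e \<otimes>\<^bsub>zhang_twist A \<tau>\<^esub> x = x" if x: "x \<in> carrier A"
  proof -
    define c where "c = homogeneous_component A x"
    define S where "S = {m. c m \<noteq> \<zero>}"
    have c: "c m \<in> grade A m" and fin: "finite S" and sum: "(\<Oplus>m\<in>S. c m) = x" for m
      using decomposition_sum[OF x] by (auto simp: c_def S_def)
    have cc: "c m \<in> carrier A" for m using c grade_closed by blast
    have "e \<otimes>\<^bsub>zhang_twist A \<tau>\<^esub> x = e \<otimes> \<tau> 0 (\<Oplus>m\<in>S. c m)"
      using zhang_twist_mult_homogeneous[OF e0 x] sum by simp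
    also have "\<dots> = e \<otimes> (\<Oplus>m\<in>S. \<tau> 0 (c m))"
      using twist_finsum[OF fin, of c 0] cc by simp
    also have "\<dots> = (\<Oplus>m\<in>S. e \<otimes> \<tau> 0 (c m))"
      using fin e cc twist_closed by (intro finsum_rdistr) auto
    also have "\<dots> = x" using hom[OF c] sum by simp
    finally show ?thesis .
  qed
qed

end

end

theory Submission
  imports Defs
begin

text \<open>
  The Zhang twist does not change which maps between free modules are graded isomorphisms.
  Acting by \<open>r\<close> in \<open>A\<^sup>\<tau>\<close> on a vector \<open>v\<close> that is homogeneous of degree \<open>d\<close> is the same as
  acting by \<open>\<tau> d r\<close> in \<open>A\<close>, and a degree-preserving map \<open>f\<close> sends \<open>v\<close> to a vector of the same
  degree \<open>d\<close>, on which the two actions are related by the very same element \<open>\<tau> d r\<close>. So an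
  \<open>A\<close>-linear degree-preserving \<open>f\<close> commutes with the twisted action on homogeneous vectors
  (\<open>compatible_change_of_action\<close>), and by additivity on all vectors
  (\<open>compatible_if_compatible_on_homogeneous\<close>). The converse is the same argument with the
  inverse of \<open>\<tau> d\<close> in place of \<open>\<tau> d\<close>.

  Hence \<open>A\<^sup>m\<close> and \<open>A\<^sup>n\<close> are graded isomorphic over \<open>A\<close> exactly if they are so over \<open>A\<^sup>\<tau>\<close>, and
  both gr-IBN and the graded module type depend on this relation between \<open>m\<close> and \<open>n\<close> only. That
  IBN implies gr-IBN holds because a graded isomorphism is in particular an isomorphism of modules.
\<close>

section \<open>Isomorphisms of free modules\<close>

lemma graded_right_module_iso_free_iff:
  "f \<in> graded_right_module_iso A (free_graded_right_module A m) (free_graded_right_module A n) \<longleftrightarrow>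
     bij_betw f ({..<m} \<rightarrow>\<^sub>E carrier A) ({..<n} \<rightarrow>\<^sub>E carrier A) \<and>
     (\<forall>v\<in>{..<m} \<rightarrow>\<^sub>E carrier A. \<forall>w\<in>{..<m} \<rightarrow>\<^sub>E carrier A.
        f (\<lambda>i\<in>{..<m}. v i \<oplus>\<^bsub>A\<^esub> w i) = (\<lambda>i\<in>{..<n}. f v i \<oplus>\<^bsub>A\<^esub> f w i)) \<and>
     (\<forall>r\<in>carrier A. \<forall>v\<in>{..<m} \<rightarrow>\<^sub>E carrier A.
        f (\<lambda>i\<in>{..<m}. v i \<otimes>\<^bsub>A\<^esub> r) = (\<lambda>i\<in>{..<n}. f v i \<otimes>\<^bsub>A\<^esub> r)) \<and>
     (\<forall>d. \<forall>v\<in>{..<m} \<rightarrow>\<^sub>E grade A d. f v \<in> {..<n} \<rightarrow>\<^sub>E grade A d)"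
  unfolding graded_right_module_iso_def right_module_iso_def iso_def hom_def
    free_graded_right_module_def free_right_module_def module.defs graded.defs
  by (auto simp: bij_betw_def)

lemma IBN_imp_gr_IBN:
  assumes "IBN A"
  shows "gr_IBN A"
proof -
  have "right_module_iso A (free_graded_right_module A m) (free_graded_right_module A n)
      = right_module_iso A (free_right_module A m) (free_right_module A n)" for m n
    unfolding right_module_iso_def iso_def hom_def
      free_graded_right_module_def free_right_module_def module.defs graded.defs
    by simp
  then show ?thesis
    using assms
    unfolding IBN_def gr_IBN_def free_graded_isomorphic_def graded_right_module_iso_def
    by blast
qed

section \<open>Degree-preserving additive maps and linearity\<close>

context graded_algebra
begin

text \<open>
  Both sides are additive in \<open>v\<close>, and every \<open>v\<close> is a finite sum of homogeneous vectors: in each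
  degree take the components of all entries of \<open>v\<close>. The product is a variable \<open>p\<close> so
  that the lemma covers the action of the algebra and that of a twist alike.
\<close>

lemma compatible_if_compatible_on_homogeneous:
  fixes p :: "'a \<Rightarrow> 'a \<Rightarrow> 'a" and f :: "(nat \<Rightarrow> 'a) \<Rightarrow> nat \<Rightarrow> 'a"
  assumes p_closed: "\<And>x. x \<in> carrier A \<Longrightarrow> p x r \<in> carrier A"
    and p_add: "\<And>x y. x \<in> carrier A \<Longrightarrow> y \<in> carrier A \<Longrightarrow> p (x \<oplus> y) r = p x r \<oplus> p y r"
    and f_closed: "f \<in> ({..<m} \<rightarrow>\<^sub>E carrier A) \<rightarrow> ({..<n} \<rightarrow>\<^sub>E carrier A)"
    and f_add: "\<And>v w. v \<in> {..<m} \<rightarrow>\<^sub>E carrier A \<Longrightarrow> w \<in> {..<m} \<rightarrow>\<^sub>E carrier A \<Longrightarrow>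
        f (\<lambda>i\<in>{..<m}. v i \<oplus> w i) = (\<lambda>i\<in>{..<n}. f v i \<oplus> f w i)"
    and hom: "\<And>d v. v \<in> {..<m} \<rightarrow>\<^sub>E grade A d \<Longrightarrow>
        f (\<lambda>i\<in>{..<m}. p (v i) r) = (\<lambda>i\<in>{..<n}. p (f v i) r)"
    and v: "v \<in> {..<m} \<rightarrow>\<^sub>E carrier A"
  shows "f (\<lambda>i\<in>{..<m}. p (v i) r) = (\<lambda>i\<in>{..<n}. p (f v i) r)"
proof -
  define c where "c i = homogeneous_component A (v i)" for i
  have vi: "v i \<in> carrier A" if "i < m" for i
    using v that by auto
  have c: "c i d \<in> grade A d" and fin: "finite {d. c i d \<noteq> \<zero>}"
    and sum: "(\<Oplus>d\<in>{d. c i d \<noteq> \<zero>}. c i d) = v i" if "i < m" for i d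
    using decomposition_sum[OF vi[OF that]] by (auto simp: c_def)
  have cc: "c i d \<in> carrier A" if "i < m" for i d
    using c[OF that] grade_closed by blast
  define T where "T = (\<Union>i<m. {d. c i d \<noteq> \<zero>})"
  have part: "f (\<lambda>i\<in>{..<m}. p ((\<lambda>i\<in>{..<m}. \<Oplus>d\<in>S. c i d) i) r)
      = (\<lambda>j\<in>{..<n}. p (f (\<lambda>i\<in>{..<m}. \<Oplus>d\<in>S. c i d) j) r)" if "finite S" for S
    using that
  proof (induction S)
    case empty
    \<comment> \<open>The zero vector is homogeneous, of degree \<open>0\<close> for instance.\<close>
    show ?case
      by (rule hom[of _ 0]) (auto simp: grade_zero split: if_splits)
  next
    case (insert a S)
    define u where "u = (\<lambda>i\<in>{..<m}. c i a)"
    define w where "w = (\<lambda>i\<in>{..<m}. \<Oplus>d\<in>S. c i d)"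
    have u_hom: "u \<in> {..<m} \<rightarrow>\<^sub>E grade A a" using c by (auto simp: u_def)
    then have u: "u \<in> {..<m} \<rightarrow>\<^sub>E carrier A" using grade_closed by blast
    have w: "w \<in> {..<m} \<rightarrow>\<^sub>E carrier A"
      using cc by (auto simp: w_def intro!: A.finsum_closed)
    have split: "(\<lambda>i\<in>{..<m}. \<Oplus>d\<in>insert a S. c i d) = (\<lambda>i\<in>{..<m}. u i \<oplus> w i)"
      using insert.hyps cc by (auto simp: u_def w_def fun_eq_iff Pi_iff)
    have pu: "(\<lambda>i\<in>{..<m}. p (u i) r) \<in> {..<m} \<rightarrow>\<^sub>E carrier A"
      and pw: "(\<lambda>i\<in>{..<m}. p (w i) r) \<in> {..<m} \<rightarrow>\<^sub>E carrier A"
      using p_closed PiE_mem[OF u] PiE_mem[OF w] by auto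
    have fu: "f u \<in> {..<n} \<rightarrow>\<^sub>E carrier A" and fw: "f w \<in> {..<n} \<rightarrow>\<^sub>E carrier A"
      using f_closed u w by auto
    have "(\<lambda>i\<in>{..<m}. p ((\<lambda>i\<in>{..<m}. u i \<oplus> w i) i) r)
        = (\<lambda>i\<in>{..<m}. (\<lambda>i\<in>{..<m}. p (u i) r) i \<oplus> (\<lambda>i\<in>{..<m}. p (w i) r) i)"
      using u w p_add by (intro restrict_ext) auto
    then have "f (\<lambda>i\<in>{..<m}. p ((\<lambda>i\<in>{..<m}. u i \<oplus> w i) i) r)
        = (\<lambda>j\<in>{..<n}. f (\<lambda>i\<in>{..<m}. p (u i) r) j \<oplus> f (\<lambda>i\<in>{..<m}. p (w i) r) j)"
      using f_add[OF pu pw] by simp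
    also have "\<dots> = (\<lambda>j\<in>{..<n}. p (f u j) r \<oplus> p (f w j) r)"
      by (intro restrict_ext) (simp only: hom[OF u_hom] insert.IH[folded w_def] restrict_apply')
    also have "\<dots> = (\<lambda>j\<in>{..<n}. p (f (\<lambda>i\<in>{..<m}. u i \<oplus> w i) j) r)"
      using f_add[OF u w] PiE_mem[OF fu] PiE_mem[OF fw] p_add by (intro restrict_ext) simp
    finally show ?case unfolding split .
  qed
  have "finite T" using fin by (auto simp: T_def)
  moreover have "(\<lambda>i\<in>{..<m}. \<Oplus>d\<in>T. c i d) = v"
  proof
    fix i
    show "(\<lambda>i\<in>{..<m}. \<Oplus>d\<in>T. c i d) i = v i"
    proof (cases "i < m")
      case True
      have "(\<Oplus>d\<in>T. c i d) = (\<Oplus>d\<in>{d. c i d \<noteq> \<zero>}. c i d)"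
        using \<open>finite T\<close> True cc
        by (intro A.add.finprod_mono_neutral_cong_right) (auto simp: T_def)
      then show ?thesis using sum[OF True] True by simp
    next
      case False
      then show ?thesis using v by (auto simp: PiE_def extensional_def)
    qed
  qed
  ultimately show ?thesis using part[of T] by simp
qed

text \<open>
  The scalar \<open>\<sigma> d r\<close> depends on the degree \<open>d\<close> but not on the vector acted upon, and \<open>f\<close>
  preserves degrees. So the scalar that translates the action before \<open>f\<close> is also the one that
  translates it after \<open>f\<close>.
\<close>

lemma compatible_change_of_action:
  fixes p q :: "'a \<Rightarrow> 'a \<Rightarrow> 'a" and \<sigma> :: "int \<Rightarrow> 'a \<Rightarrow> 'a"
    and f :: "(nat \<Rightarrow> 'a) \<Rightarrow> nat \<Rightarrow> 'a"
  assumes p_closed: "\<And>x. x \<in> carrier A \<Longrightarrow> p x r \<in> carrier A"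
    and p_add: "\<And>x y. x \<in> carrier A \<Longrightarrow> y \<in> carrier A \<Longrightarrow> p (x \<oplus> y) r = p x r \<oplus> p y r"
    and \<sigma>_closed: "\<And>d. \<sigma> d r \<in> carrier A"
    and p_q: "\<And>x d. x \<in> grade A d \<Longrightarrow> p x r = q x (\<sigma> d r)"
    and f_closed: "f \<in> ({..<m} \<rightarrow>\<^sub>E carrier A) \<rightarrow> ({..<n} \<rightarrow>\<^sub>E carrier A)"
    and f_add: "\<And>v w. v \<in> {..<m} \<rightarrow>\<^sub>E carrier A \<Longrightarrow> w \<in> {..<m} \<rightarrow>\<^sub>E carrier A \<Longrightarrow>
        f (\<lambda>i\<in>{..<m}. v i \<oplus> w i) = (\<lambda>i\<in>{..<n}. f v i \<oplus> f w i)"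
    and f_grade: "\<And>d v. v \<in> {..<m} \<rightarrow>\<^sub>E grade A d \<Longrightarrow> f v \<in> {..<n} \<rightarrow>\<^sub>E grade A d"
    and f_q: "\<And>s v. s \<in> carrier A \<Longrightarrow> v \<in> {..<m} \<rightarrow>\<^sub>E carrier A \<Longrightarrow>
        f (\<lambda>i\<in>{..<m}. q (v i) s) = (\<lambda>i\<in>{..<n}. q (f v i) s)"
    and v: "v \<in> {..<m} \<rightarrow>\<^sub>E carrier A"
  shows "f (\<lambda>i\<in>{..<m}. p (v i) r) = (\<lambda>i\<in>{..<n}. p (f v i) r)"
proof (rule compatible_if_compatible_on_homogeneous
    [where p = p and r = r, OF p_closed p_add f_closed f_add _ v])
  fix d w
  assume w: "w \<in> {..<m} \<rightarrow>\<^sub>E grade A d"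
  then have wc: "w \<in> {..<m} \<rightarrow>\<^sub>E carrier A" using grade_closed by blast
  have "(\<lambda>i\<in>{..<m}. p (w i) r) = (\<lambda>i\<in>{..<m}. q (w i) (\<sigma> d r))"
    using w p_q by (intro restrict_ext) auto
  then have "f (\<lambda>i\<in>{..<m}. p (w i) r) = (\<lambda>i\<in>{..<n}. q (f w i) (\<sigma> d r))"
    using f_q[OF \<sigma>_closed wc] by simp
  also have "\<dots> = (\<lambda>i\<in>{..<n}. p (f w i) r)"
    using f_grade[OF w] p_q by (intro restrict_ext) (metis PiE_mem)
  finally show "f (\<lambda>i\<in>{..<m}. p (w i) r) = (\<lambda>i\<in>{..<n}. p (f w i) r)" .
qed

section \<open>Additivity of the twisted product in the left factor\<close>

lemma homogeneous_component_add:
  assumes "x \<in> carrier A" "y \<in> carrier A"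
  shows "homogeneous_component A (x \<oplus> y)
    = (\<lambda>n. homogeneous_component A x n \<oplus> homogeneous_component A y n)"
proof (rule homogeneous_component_eq)
  define c where "c = homogeneous_component A x"
  define d where "d = homogeneous_component A y"
  define T where "T = {n. c n \<noteq> \<zero>} \<union> {n. d n \<noteq> \<zero>}"
  have c: "c n \<in> grade A n" and d: "d n \<in> grade A n" for n
    using decomposition_sum(1) assms by (auto simp: c_def d_def)
  have cc: "c n \<in> carrier A" and dc: "d n \<in> carrier A" for n
    using c d grade_closed by blast+
  have T: "finite T"
    using decomposition_sum(2) assms by (auto simp: T_def c_def d_def)
  have sub: "{n. c n \<oplus> d n \<noteq> \<zero>} \<subseteq> T" by (auto simp: T_def)
  have sum_c: "(\<Oplus>n\<in>T. c n) = x"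
  proof -
    have "(\<Oplus>n\<in>T. c n) = (\<Oplus>n\<in>{n. c n \<noteq> \<zero>}. c n)"
      using T cc by (intro A.add.finprod_mono_neutral_cong_right) (auto simp: T_def)
    then show ?thesis using decomposition_sum(3)[OF assms(1)] by (simp add: c_def)
  qed
  have sum_d: "(\<Oplus>n\<in>T. d n) = y"
  proof -
    have "(\<Oplus>n\<in>T. d n) = (\<Oplus>n\<in>{n. d n \<noteq> \<zero>}. d n)"
      using T dc by (intro A.add.finprod_mono_neutral_cong_right) (auto simp: T_def)
    then show ?thesis using decomposition_sum(3)[OF assms(2)] by (simp add: d_def)
  qed
  have "(\<Oplus>n\<in>{n. c n \<oplus> d n \<noteq> \<zero>}. c n \<oplus> d n) = (\<Oplus>n\<in>T. c n \<oplus> d n)"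
    using T sub cc dc
    by (intro A.add.finprod_mono_neutral_cong_right[symmetric]) auto
  also have "\<dots> = x \<oplus> y"
    using cc dc sum_c sum_d by (subst A.finsum_addf) auto
  finally have "x \<oplus> y = (\<Oplus>n\<in>{n. c n \<oplus> d n \<noteq> \<zero>}. c n \<oplus> d n)" by simp
  moreover have "c n \<oplus> d n \<in> grade A n" for n
    using subgroup.m_closed[OF submodule.axioms(1)[OF grade_submodule[of n]] c d] by simp
  ultimately show "is_decomposition A (x \<oplus> y)
      (\<lambda>n. homogeneous_component A x n \<oplus> homogeneous_component A y n)"
    using finite_subset[OF sub T]
    by (simp add: is_decomposition_def c_def d_def)
  show "x \<oplus> y \<in> carrier A" using assms by simp
qed

end

context twisting_system
begin

text \<open>
  Enlarging the index set beyond the support is what makes products with different left factors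
  comparable.
\<close>

lemma zhang_twist_mult_eq_sum:
  assumes "x \<in> carrier A" "r \<in> carrier A" "finite T"
    and "{d. homogeneous_component A x d \<noteq> \<zero>} \<subseteq> T"
  shows "x \<otimes>\<^bsub>zhang_twist A \<tau>\<^esub> r = (\<Oplus>d\<in>T. homogeneous_component A x d \<otimes> \<tau> d r)"
proof -
  have "homogeneous_component A x d \<in> carrier A" for d
    using decomposition_sum(1)[OF assms(1)] grade_closed by blast
  then have "(\<Oplus>d\<in>T. homogeneous_component A x d \<otimes> \<tau> d r)
      = (\<Oplus>d\<in>{d. homogeneous_component A x d \<noteq> \<zero>}. homogeneous_component A x d \<otimes> \<tau> d r)"
    using assms twist_closed
    by (intro A.add.finprod_mono_neutral_cong_right) auto
  then show ?thesis by (simp add: zhang_twist_def)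
qed

lemma zhang_twist_mult_closed:
  assumes "x \<in> carrier A" "r \<in> carrier A"
  shows "x \<otimes>\<^bsub>zhang_twist A \<tau>\<^esub> r \<in> carrier A"
proof -
  have "homogeneous_component A x d \<in> carrier A" for d
    using decomposition_sum(1)[OF assms(1)] grade_closed by blast
  then show ?thesis
    using assms twist_closed by (auto simp: zhang_twist_def intro!: A.finsum_closed)
qed

lemma zhang_twist_distrib_right:
  assumes "x \<in> carrier A" "y \<in> carrier A" "r \<in> carrier A"
  shows "(x \<oplus> y) \<otimes>\<^bsub>zhang_twist A \<tau>\<^esub> r
    = x \<otimes>\<^bsub>zhang_twist A \<tau>\<^esub> r \<oplus> y \<otimes>\<^bsub>zhang_twist A \<tau>\<^esub> r"
proof -
  define c where "c = homogeneous_component A x"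
  define d where "d = homogeneous_component A y"
  define T where "T = {n. c n \<noteq> \<zero>} \<union> {n. d n \<noteq> \<zero>}"
  have cc: "c n \<in> carrier A" and dc: "d n \<in> carrier A" for n
    using decomposition_sum(1) assms grade_closed unfolding c_def d_def by blast+
  have T: "finite T"
    using decomposition_sum(2) assms by (auto simp: T_def c_def d_def)
  have sub: "{n. c n \<oplus> d n \<noteq> \<zero>} \<subseteq> T" by (auto simp: T_def)
  have cd: "homogeneous_component A (x \<oplus> y) = (\<lambda>n. c n \<oplus> d n)"
    using homogeneous_component_add assms by (simp add: c_def d_def)
  have "(x \<oplus> y) \<otimes>\<^bsub>zhang_twist A \<tau>\<^esub> r = (\<Oplus>n\<in>T. (c n \<oplus> d n) \<otimes> \<tau> n r)"
    using assms T sub zhang_twist_mult_eq_sum[of "x \<oplus> y" r T] unfolding cd by simp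
  also have "\<dots> = (\<Oplus>n\<in>T. c n \<otimes> \<tau> n r \<oplus> d n \<otimes> \<tau> n r)"
    using cc dc assms twist_closed by (simp add: A.l_distr)
  also have "\<dots> = (\<Oplus>n\<in>T. c n \<otimes> \<tau> n r) \<oplus> (\<Oplus>n\<in>T. d n \<otimes> \<tau> n r)"
    using cc dc assms twist_closed by (subst A.finsum_addf) auto
  also have "\<dots> = x \<otimes>\<^bsub>zhang_twist A \<tau>\<^esub> r \<oplus> y \<otimes>\<^bsub>zhang_twist A \<tau>\<^esub> r"
    using assms T zhang_twist_mult_eq_sum[of x r T] zhang_twist_mult_eq_sum[of y r T]
    by (auto simp: T_def c_def d_def)
  finally show ?thesis .
qed

section \<open>Graded isomorphisms over the twist\<close>

text \<open>
  Zhang's isomorphism between the categories of graded modules over \<open>A\<close> and over its twist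
  changes only the action on a module and is the identity on maps. It sends \<open>A\<^sup>n\<close> to the free
  module of rank \<open>n\<close> over the twist.
\<close>

lemma graded_right_module_iso_zhang_twist:
  defines "B \<equiv> zhang_twist A \<tau>"
  shows "graded_right_module_iso B (free_graded_right_module B m) (free_graded_right_module B n)
    = graded_right_module_iso A (free_graded_right_module A m) (free_graded_right_module A n)"
proof -
  have B: "carrier B = carrier A" "ring.add B = ring.add A" "grade B = grade A"
    by (simp_all add: B_def zhang_twist_def)
  have B_closed: "x \<otimes>\<^bsub>B\<^esub> r \<in> carrier A" if "x \<in> carrier A" "r \<in> carrier A" for x r
    using zhang_twist_mult_closed that by (simp add: B_def)
  have B_add: "(x \<oplus> y) \<otimes>\<^bsub>B\<^esub> r = x \<otimes>\<^bsub>B\<^esub> r \<oplus> y \<otimes>\<^bsub>B\<^esub> r"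
    if "x \<in> carrier A" "y \<in> carrier A" "r \<in> carrier A" for x y r
    using zhang_twist_distrib_right that by (simp add: B_def)
  have B_hom: "x \<otimes>\<^bsub>B\<^esub> r = x \<otimes> \<tau> d r" if "x \<in> grade A d" "r \<in> carrier A" for x r d
    using zhang_twist_mult_homogeneous that by (simp add: B_def)
  define \<rho> where "\<rho> d = inv_into (carrier A) (\<tau> d)" for d
  have \<rho>: "\<rho> d r \<in> carrier A" "\<tau> d (\<rho> d r) = r" if "r \<in> carrier A" for d r
    using twist_bij[of d] that unfolding \<rho>_def
    by (auto simp: bij_betw_def inv_into_into f_inv_into_f)
  have A_hom: "x \<otimes> r = x \<otimes>\<^bsub>B\<^esub> \<rho> d r" if "x \<in> grade A d" "r \<in> carrier A" for x r d
    using B_hom[OF that(1) \<rho>(1)] \<rho>(2) that by simp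
  have linear_iff: "(\<forall>r\<in>carrier A. \<forall>v\<in>{..<m} \<rightarrow>\<^sub>E carrier A.
        f (\<lambda>i\<in>{..<m}. v i \<otimes>\<^bsub>B\<^esub> r) = (\<lambda>i\<in>{..<n}. f v i \<otimes>\<^bsub>B\<^esub> r)) \<longleftrightarrow>
      (\<forall>r\<in>carrier A. \<forall>v\<in>{..<m} \<rightarrow>\<^sub>E carrier A.
        f (\<lambda>i\<in>{..<m}. v i \<otimes> r) = (\<lambda>i\<in>{..<n}. f v i \<otimes> r))"
    if bij: "bij_betw f ({..<m} \<rightarrow>\<^sub>E carrier A) ({..<n} \<rightarrow>\<^sub>E carrier A)"
      and f_add: "\<And>v w. v \<in> {..<m} \<rightarrow>\<^sub>E carrier A \<Longrightarrow> w \<in> {..<m} \<rightarrow>\<^sub>E carrier A \<Longrightarrow>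
        f (\<lambda>i\<in>{..<m}. v i \<oplus> w i) = (\<lambda>i\<in>{..<n}. f v i \<oplus> f w i)"
      and f_grade: "\<And>d v. v \<in> {..<m} \<rightarrow>\<^sub>E grade A d \<Longrightarrow> f v \<in> {..<n} \<rightarrow>\<^sub>E grade A d"
    for f :: "(nat \<Rightarrow> 'a) \<Rightarrow> nat \<Rightarrow> 'a"
  proof -
    have f_closed: "f \<in> ({..<m} \<rightarrow>\<^sub>E carrier A) \<rightarrow> ({..<n} \<rightarrow>\<^sub>E carrier A)"
      using bij by (rule bij_betw_imp_funcset)
    show ?thesis
    proof (intro iffI ballI)
      fix r v
      assume lin: "\<forall>r\<in>carrier A. \<forall>v\<in>{..<m} \<rightarrow>\<^sub>E carrier A.
          f (\<lambda>i\<in>{..<m}. v i \<otimes> r) = (\<lambda>i\<in>{..<n}. f v i \<otimes> r)"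
        and r: "r \<in> carrier A" and v: "v \<in> {..<m} \<rightarrow>\<^sub>E carrier A"
      show "f (\<lambda>i\<in>{..<m}. v i \<otimes>\<^bsub>B\<^esub> r) = (\<lambda>i\<in>{..<n}. f v i \<otimes>\<^bsub>B\<^esub> r)"
        by (rule compatible_change_of_action
            [where p = "\<lambda>x r. x \<otimes>\<^bsub>B\<^esub> r" and q = "\<lambda>x r. x \<otimes> r" and \<sigma> = \<tau> and r = r,
              OF B_closed[OF _ r] B_add[OF _ _ r] twist_closed[OF r] B_hom[OF _ r]
                f_closed f_add f_grade lin[rule_format] v])
    next
      fix r v
      assume lin: "\<forall>r\<in>carrier A. \<forall>v\<in>{..<m} \<rightarrow>\<^sub>E carrier A.
          f (\<lambda>i\<in>{..<m}. v i \<otimes>\<^bsub>B\<^esub> r) = (\<lambda>i\<in>{..<n}. f v i \<otimes>\<^bsub>B\<^esub> r)"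
        and r: "r \<in> carrier A" and v: "v \<in> {..<m} \<rightarrow>\<^sub>E carrier A"
      show "f (\<lambda>i\<in>{..<m}. v i \<otimes> r) = (\<lambda>i\<in>{..<n}. f v i \<otimes> r)"
        by (rule compatible_change_of_action
            [where p = "\<lambda>x r. x \<otimes> r" and q = "\<lambda>x r. x \<otimes>\<^bsub>B\<^esub> r" and \<sigma> = \<rho> and r = r,
              OF A.m_closed[OF _ r] A.l_distr[OF _ _ r] \<rho>(1)[OF r] A_hom[OF _ r]
                f_closed f_add f_grade lin[rule_format] v])
    qed
  qed
  \<comment> \<open>Linearity is the third conjunct in the description of the isomorphisms, and its
    equivalence for the two actions uses the fourth, preservation of degrees.\<close>
  have conj_cong_outer: "(P \<and> Q \<and> R \<and> S) \<longleftrightarrow> (P \<and> Q \<and> R' \<and> S)"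
    if "P \<Longrightarrow> Q \<Longrightarrow> S \<Longrightarrow> R \<longleftrightarrow> R'" for P Q R R' S
    using that by blast
  show ?thesis
    unfolding set_eq_iff graded_right_module_iso_free_iff B
    by (intro allI conj_cong_outer linear_iff) blast+
qed

end

theorem proposition4p10:
  fixes K :: "('k, 'c) ring_scheme"
    and A :: "('k, 'a, 'e) graded_scheme"
    and \<tau> :: "int \<Rightarrow> 'a \<Rightarrow> 'a"
  assumes "field K"
    and "graded_algebra K A"
    and "twisting_system K A \<tau>"
  shows "(gr_IBN A \<longleftrightarrow> gr_IBN (zhang_twist A \<tau>)) \<and>
         (\<not> gr_IBN A \<longrightarrow> graded_module_type A = graded_module_type (zhang_twist A \<tau>)) \<and>
         (IBN A \<longrightarrow> gr_IBN A)"
proof -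
  interpret twisting_system K A \<tau> by fact
  have "free_graded_isomorphic (zhang_twist A \<tau>) = free_graded_isomorphic A"
    by (simp add: fun_eq_iff free_graded_isomorphic_def graded_right_module_iso_zhang_twist)
  then show ?thesis
    using IBN_imp_gr_IBN[of A] by (simp add: gr_IBN_def graded_module_type_def)
qed

end
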